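(* Let $k$ be a positive integer, let $\mathbb{F}$ be a field, let $G$ be an $n$-vertex graph, and let $A\in\mathcal{A}_\mathbb{F}(G)$. Let $p(x)\in\mathbb{F}_k[x]$ be a polynomial such that $(p(A))_{uu}\neq 0$ for each $u\in V(G)$. Then $$\alpha_k(G)\leq\Theta(G^k)\leq\mathrm{rank}_\mathbb{F}(p(A)).$$
   Context: Graphs are finite, simple, undirected, with nonempty vertex set $V(G)$ and edge set $E(G)$. A $k$-independent set of $G$ is a set of vertices any two distinct members of which are at distance greater than $k$ in $G$ (vertices in different components are at infinite distance); $\alpha_k(G)$ is the maximum size of a $k$-independent set, and $\alpha(H)$ is the usual independence number of a graph $H$. The power graph $G^k$ has the same vertices as $G$, two distinct vertices being adjacent iff they are at distance at most $k$ in $G$. $\mathcal{A}_\mathbb{F}(G)$ is the set of $|V(G)|\times|V(G)|$ matrices $A$ over $\mathbb{F}$ (not necessarily symmetric), indexed by the vertices of $G$, with $(A)_{ij}=0$ whenever $i\neq j$ and $\{i,j\}\notin E(G)$. $\mathbb{F}_k[x]$ is the set of polynomials over $\mathbb{F}$ of degree at most $k$. $\mathrm{rank}_\mathbb{F}$ denotes rank over $\mathbb{F}$. Shannon capacity: for a graph $H$ and an integer $t\ge 1$, $H^{\square t}$ is the graph with vertex set $V(H)^t$ in which two distinct vertices $u_1\cdots u_t$ and $v_1\cdots v_t$ are adjacent iff for each $i\in\{1,\ldots,t\}$ either $u_i=v_i$ or $\{u_i,v_i\}\in E(H)$. The Shannon capacity of $H$ is $\Theta(H)=\sup_{t\ge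 1}\alpha(H^{\square t})^{1/t}$. *)

theory Defs
  imports
    "HOL-Analysis.Analysis"
    "HOL-Computational_Algebra.Polynomial"
    "Graph_Theory.Pair_Digraph"
    "Graph_Theory.Shortest_Path"
begin

text \<open>
  A finite simple undirected graph is a \<open>pair_graph\<close>: finite, loop-free, with a symmetric arc
  relation, so that an edge \<open>{u, v}\<close> is the pair of arcs \<open>(u, v)\<close>, \<open>(v, u)\<close>.
\<close>

definition gdist :: "'v pair_pre_digraph \<Rightarrow> 'v \<Rightarrow> 'v \<Rightarrow> ereal" where
  "gdist G u v = wf_digraph.\<mu> (with_proj G) (\<lambda>_. 1) u v"
  \<comment> \<open>equal to \<open>\<infinity>\<close> when there is no walk from \<open>u\<close> to \<open>v\<close>\<close>

definition k_independent :: "nat \<Rightarrow> 'v pair_pre_digraph \<Rightarrow> 'v set \<Rightarrow> bool" where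
  "k_independent k G S \<longleftrightarrow>
     S \<subseteq> pverts G \<and> (\<forall>u\<in>S. \<forall>v\<in>S. u \<noteq> v \<longrightarrow> gdist G u v > ereal (real k))"

definition k_independence_number :: "nat \<Rightarrow> 'v pair_pre_digraph \<Rightarrow> nat" where
  "k_independence_number k G = Max (card ` {S. k_independent k G S})"

definition independent_set :: "'v pair_pre_digraph \<Rightarrow> 'v set \<Rightarrow> bool" where
  "independent_set H S \<longleftrightarrow> S \<subseteq> pverts H \<and> (\<forall>u\<in>S. \<forall>v\<in>S. (u, v) \<notin> parcs H)"

definition independence_number :: "'v pair_pre_digraph \<Rightarrow> nat" where
  "independence_number H = Max (card ` {S. independent_set H S})"

definition power_graph :: "'v pair_pre_digraph \<Rightarrow> nat \<Rightarrow> 'v pair_pre_digraph" where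
  "power_graph G k =
     \<lparr> pverts = pverts G,
       parcs = {(u, v). u \<in> pverts G \<and> v \<in> pverts G \<and> u \<noteq> v \<and> gdist G u v \<le> ereal (real k)} \<rparr>"

definition strong_power :: "'v pair_pre_digraph \<Rightarrow> nat \<Rightarrow> 'v list pair_pre_digraph" where
  "strong_power H t =
     (let V = {us. length us = t \<and> set us \<subseteq> pverts H} in
      \<lparr> pverts = V,
        parcs = {(us, vs). us \<in> V \<and> vs \<in> V \<and> us \<noteq> vs \<and>
                   (\<forall>i<t. us ! i = vs ! i \<or> (us ! i, vs ! i) \<in> parcs H)} \<rparr>)"

text \<open>
  The supremum is taken in the conditionally complete type of reals; lemma
  \<open>bdd_above_shannon\<close> below shows that it is a genuine supremum for finite graphs.
\<close>

definition shannon_capacity :: "'v pair_pre_digraph \<Rightarrow> real" where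
  "shannon_capacity H = (SUP t\<in>{1..}. root t (real (independence_number (strong_power H t))))"

text \<open>The class-instance product and power on \<open>'a ^ 'v ^ 'v\<close> are componentwise, hence the
  following two definitions for the ring of square matrices.\<close>

primrec matrix_power :: "'a::semiring_1 ^ 'v ^ 'v \<Rightarrow> nat \<Rightarrow> 'a ^ 'v ^ 'v" where
  "matrix_power A 0 = mat 1"
| "matrix_power A (Suc i) = A ** matrix_power A i"

definition matrix_poly :: "'a::comm_semiring_1 poly \<Rightarrow> 'a ^ 'v ^ 'v \<Rightarrow> 'a ^ 'v ^ 'v" where
  "matrix_poly p A = (\<Sum>i\<le>degree p. mat (coeff p i) ** matrix_power A i)"

definition graph_matrices :: "'v::finite pair_pre_digraph \<Rightarrow> ('a::zero ^ 'v ^ 'v) set" where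
  "graph_matrices G = {A. \<forall>i j. i \<noteq> j \<and> (i, j) \<notin> parcs G \<longrightarrow> A $ i $ j = 0}"


lemma (in pair_sym_digraph) awalk_swap:
  "awalk u p v \<Longrightarrow> awalk v (rev (map prod.swap p)) u"
proof (induction p arbitrary: u)
  case Nil
  then show ?case by (auto simp: awalk_def)
next
  case (Cons e p)
  then obtain w where e: "e = (u, w)" "(u, w) \<in> parcs G" "awalk w p v"
    by (cases e) (auto simp: awalk_Cons_iff)
  have "(w, u) \<in> parcs G"
    using pair_sym_arcs e(2) by (auto simp: symmetric_def dest: symD)
  then have "awalk w [(w, u)] u"
    by (auto simp: awalk_Cons_iff awalk_Nil_iff dest: in_arcsD2)
  then show ?case using Cons.IH[OF e(3)] e(1) by (simp add: awalk_appendI)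
qed

lemma (in pair_sym_digraph) gdist_sym: "gdist G u v = gdist G v u"
proof -
  have le: "gdist G a b \<le> gdist G b a" for a b
    unfolding gdist_def \<mu>_def
  proof (rule INF_mono, safe)
    fix p assume "awalk b p a"
    then show "\<exists>q\<in>{q. awalk a q b}. ereal (awalk_cost (\<lambda>_. 1) q) \<le> ereal (awalk_cost (\<lambda>_. 1) p)"
      by (intro bexI[of _ "rev (map prod.swap p)"])
         (use awalk_swap in \<open>auto simp: awalk_cost_def sum_list_triv\<close>)
  qed
  show ?thesis by (rule antisym) (rule le)+
qed

lemma pair_graph_power_graph:
  assumes "pair_graph G"
  shows "pair_graph (power_graph G k)"
proof -
  interpret pair_graph G by fact
  have "parcs (power_graph G k) \<subseteq> pverts G \<times> pverts G"
    by (auto simp: power_graph_def)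
  then have "finite (parcs (power_graph G k))"
    using pair_finite_verts by (meson finite_SigmaI finite_subset)
  then show ?thesis
    using pair_finite_verts
    by unfold_locales (auto simp: power_graph_def symmetric_def gdist_sym intro!: symI)
qed

lemma pair_graph_strong_power:
  assumes "pair_graph H"
  shows "pair_graph (strong_power H t)"
proof -
  interpret pair_graph H by fact
  have sym: "(a, b) \<in> parcs H \<Longrightarrow> (b, a) \<in> parcs H" for a b
    using pair_sym_arcs by (auto simp: symmetric_def dest: symD)
  have fin: "finite (pverts (strong_power H t))"
    using finite_lists_length_eq[OF pair_finite_verts, of t]
    by (simp add: strong_power_def Let_def conj_commute)
  have "parcs (strong_power H t) \<subseteq> pverts (strong_power H t) \<times> pverts (strong_power H t)"
    by (auto simp: strong_power_def Let_def)
  then have "finite (parcs (strong_power H t))"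
    using fin by (meson finite_SigmaI finite_subset)
  moreover have "symmetric (with_proj (strong_power H t))"
    unfolding symmetric_def by (auto simp: strong_power_def Let_def intro!: symI) (metis sym)+
  ultimately show ?thesis using fin
    by unfold_locales (auto simp: strong_power_def Let_def)
qed

lemma independence_number_le:
  assumes "finite (pverts H)"
  shows "independence_number H \<le> card (pverts H)"
proof -
  have sub: "{S. independent_set H S} \<subseteq> Pow (pverts H)"
    by (auto simp: independent_set_def)
  then have "finite {S. independent_set H S}" using assms by (simp add: finite_subset)
  moreover have "independent_set H {}" by (simp add: independent_set_def)
  ultimately show ?thesis
    unfolding independence_number_def using sub assms
    by (subst Max_le_iff) (auto intro!: card_mono)
qed

lemma bdd_above_shannon:
  assumes "finite (pverts H)"
  shows "bdd_above ((\<lambda>t. root t (real (independence_number (strong_power H t)))) ` {1..})"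
proof (rule bdd_aboveI2)
  fix t :: nat assume t: "t \<in> {1..}"
  have verts: "pverts (strong_power H t) = {us. set us \<subseteq> pverts H \<and> length us = t}"
    by (auto simp: strong_power_def Let_def)
  have "independence_number (strong_power H t) \<le> card (pverts H) ^ t"
    using independence_number_le[of "strong_power H t"]
      finite_lists_length_eq[OF assms, of t] card_lists_length_eq[OF assms, of t]
    by (simp add: verts)
  then have "real (independence_number (strong_power H t)) \<le> real (card (pverts H)) ^ t"
    by (metis of_nat_le_iff of_nat_power)
  then have "root t (real (independence_number (strong_power H t)))
      \<le> root t (real (card (pverts H)) ^ t)"
    using t by (intro real_root_le_mono) auto
  also have "\<dots> = real (card (pverts H))"
    using t by (simp add: real_root_power_cancel)
  finally show "root t (real (independence_number (strong_power H t))) \<le> real (card (pverts H))" .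
qed

end

theory Submission
  imports Defs "HOL-Library.Function_Algebras"
begin

text \<open>
  An entry \<open>(u, v)\<close> of \<open>A\<^sup>i\<close> is a sum over walks of length at most \<open>i\<close>, so \<open>M = p(A)\<close> has a
  nonzero diagonal and vanishes at distinct non-adjacent vertices of the power graph. On an
  independent set \<open>S\<close> of the \<open>t\<close>-th strong power, the \<open>t\<close>-fold Kronecker power of \<open>M\<close> is therefore
  diagonal with nonzero diagonal entries; tensoring a rank factorization of \<open>M\<close> with itself
  factors it through a space of dimension \<open>(rank M)\<^sup>t\<close>, whence \<open>card S \<le> (rank M)\<^sup>t\<close>.
\<close>

lemma gdist_le_walk_length:
  assumes "pair_graph G" "pre_digraph.awalk (with_proj G) u q v" "length q \<le> k"
  shows "gdist G u v \<le> ereal (real k)"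
proof -
  interpret pair_graph G by fact
  have "gdist G u v \<le> ereal (awalk_cost (\<lambda>_. 1) q)"
    unfolding gdist_def \<mu>_def using assms(2) by (intro INF_lower) simp
  also have "\<dots> \<le> ereal (real k)"
    using assms(3) by (simp add: awalk_cost_def sum_list_triv)
  finally show ?thesis .
qed

text \<open>A nonzero entry of a product has a nonzero summand, which supplies the next vertex of
  the walk. Diagonal entries of \<open>A\<close> are unrestricted, so a factor may stay at its
  vertex; hence a bound on \<open>length q\<close> and not an equality.\<close>

lemma matrix_power_nonzero_imp_walk:
  fixes G :: "'v::finite pair_pre_digraph" and A :: "'a::field ^ 'v ^ 'v"
  assumes "pair_graph G" "pverts G = UNIV" "A \<in> graph_matrices G"
    and "matrix_power A i $ u $ v \<noteq> 0"
  shows "\<exists>q. pre_digraph.awalk (with_proj G) u q v \<and> length q \<le> i"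
  using assms(4)
proof (induction i arbitrary: u)
  interpret pair_graph G by fact
  case 0
  then have "u = v" by (simp add: mat_def split: if_splits)
  then show ?case using assms(2) by (intro exI[of _ "[]"]) (simp add: awalk_Nil_iff)
next
  interpret pair_graph G by fact
  case (Suc i)
  then have "(\<Sum>w\<in>UNIV. A $ u $ w * matrix_power A i $ w $ v) \<noteq> 0"
    by (simp add: matrix_matrix_mult_def)
  then obtain w where w: "A $ u $ w * matrix_power A i $ w $ v \<noteq> 0"
    by (meson sum.not_neutral_contains_not_neutral)
  then obtain q where q: "awalk w q v" "length q \<le> i" using Suc.IH by fastforce
  show ?case
  proof (cases "u = w")
    case True
    then show ?thesis using q by (intro exI[of _ q]) simp
  next
    case False
    then have "(u, w) \<in> parcs G" using w assms(3) by (auto simp: graph_matrices_def)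
    then show ?thesis using q assms(2)
      by (intro exI[of _ "(u, w) # q"]) (simp add: awalk_Cons_iff)
  qed
qed

text \<open>Only powers up to \<open>degree p\<close> occur, and a nonzero entry in one of them
  would give a walk of length at most \<open>k\<close>.\<close>

lemma matrix_poly_eq_0_if_distant:
  fixes G :: "'v::finite pair_pre_digraph" and A :: "'a::field ^ 'v ^ 'v"
  assumes "pair_graph G" "pverts G = UNIV" "A \<in> graph_matrices G" "degree p \<le> k"
    and "gdist G u v > ereal (real k)"
  shows "matrix_poly p A $ u $ v = 0"
proof -
  have "matrix_power A i $ u $ v = 0" if "i \<le> degree p" for i
    using matrix_power_nonzero_imp_walk[OF assms(1-3), of i u v] that assms(4,5)
      gdist_le_walk_length[OF assms(1)] by (metis le_trans not_le)
  then have "(mat (coeff p i) ** matrix_power A i) $ u $ v = 0" if "i \<le> degree p" for i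
    using that by (auto simp: matrix_matrix_mult_def mat_def intro!: sum.neutral)
  then show ?thesis by (simp add: matrix_poly_def)
qed

text \<open>\<open>B\<close> is a basis of the row space, and \<open>c b u\<close> is the coordinate
  of row \<open>u\<close> at the basis vector \<open>b\<close>.\<close>

lemma rank_factorization:
  fixes M :: "'a::field ^ 'n ^ 'm"
  obtains B :: "('a ^ 'n) set" and c where "finite B" "card B = rank M"
    and "\<And>u v. M $ u $ v = (\<Sum>b\<in>B. c b u * b $ v)"
proof -
  obtain B where B: "B \<subseteq> rows M" "vec.independent B" "rows M \<subseteq> vec.span B"
    "card B = vec.dim (rows M)"
    using vec.basis_exists by blast
  have fin: "finite B" using B(2) by (rule vec.finiteI_independent)
  have "M $ u $ v = (\<Sum>b\<in>B. vec.representation B (row u M) b * b $ v)" for u v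
  proof -
    have "row u M \<in> vec.span B" using B(3) by (auto simp: rows_def)
    then have "(\<Sum>b\<in>B. vec.representation B (row u M) b *s b) = row u M"
      using vec.sum_representation_eq[OF B(2) _ fin] by blast
    then have "row u M $ v = (\<Sum>b\<in>B. vec.representation B (row u M) b *s b) $ v"
      by simp
    then show ?thesis by (simp add: row_def)
  qed
  then show thesis using that[of B "\<lambda>b u. vec.representation B (row u M) b"] B(4) fin
    by (metis row_rank_def_gen)
qed

text \<open>Full distributivity: a list records which summand is chosen from each factor. It turns a
  product of entries of a factored matrix into a single sum over words in the basis.\<close>

lemma prod_sum_lists:
  fixes f :: "nat \<Rightarrow> 'b \<Rightarrow> 'a::comm_semiring_1"
  assumes "finite B"
  shows "(\<Prod>i<t. \<Sum>b\<in>B. f i b) = (\<Sum>bs | set bs \<subseteq> B \<and> length bs = t. \<Prod>i<t. f i (bs ! i))"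
proof (induction t arbitrary: f)
  case 0
  have "{bs. set bs \<subseteq> B \<and> length bs = 0} = {[]}" by auto
  then show ?case by simp
next
  case (Suc t)
  let ?L = "{bs. set bs \<subseteq> B \<and> length bs = t}"
  have L: "{bs. set bs \<subseteq> B \<and> length bs = Suc t} = (\<lambda>(b, bs). b # bs) ` (B \<times> ?L)"
    by (auto simp: length_Suc_conv image_iff)
  \<comment> \<open>Lists grow at the head, so factor 0 is split off and the induction hypothesis is
    used for the shifted family.\<close>
  have "(\<Prod>i<Suc t. \<Sum>b\<in>B. f i b) = (\<Sum>b\<in>B. f 0 b) * (\<Sum>bs\<in>?L. \<Prod>i<t. f (Suc i) (bs ! i))"
    using Suc.IH[of "\<lambda>i. f (Suc i)"] by (simp only: prod.lessThan_Suc_shift)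
  also have "\<dots> = (\<Sum>(b, bs)\<in>B \<times> ?L. \<Prod>i<Suc t. f i ((b # bs) ! i))"
    by (simp only: prod.lessThan_Suc_shift sum_product sum.cartesian_product) simp
  also have "\<dots> = (\<Sum>bs | set bs \<subseteq> B \<and> length bs = Suc t. \<Prod>i<Suc t. f i (bs ! i))"
    unfolding L by (subst sum.reindex) (auto simp: inj_on_def case_prod_beta)
  finally show ?case .
qed

lemma sum_fun_apply: "(\<Sum>a\<in>T. g a) w = (\<Sum>a\<in>T. g a w)"
  by (induction T rule: infinite_finite_induct) auto

text \<open>
  The pairing with the \<open>x u\<close> shows that the \<open>y u\<close>, cut off outside \<open>W\<close>, are linearly independent.
\<close>
lemma card_le_if_diagonal_pairing:
  fixes x :: "'s \<Rightarrow> 'w \<Rightarrow> 'a::field" and y :: "'s \<Rightarrow> 'w \<Rightarrow> 'a"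
  assumes "finite S" "finite W"
    and diag: "\<And>u. u \<in> S \<Longrightarrow> (\<Sum>w\<in>W. x u w * y u w) \<noteq> 0"
    and off: "\<And>u v. u \<in> S \<Longrightarrow> v \<in> S \<Longrightarrow> u \<noteq> v \<Longrightarrow> (\<Sum>w\<in>W. x u w * y v w) = 0"
  shows "card S \<le> card W"
proof -
  interpret fs: vector_space "\<lambda>(c :: 'a) (f :: 'w \<Rightarrow> 'a) w. c * f w"
    by unfold_locales (simp_all add: fun_eq_iff algebra_simps)
  \<comment> \<open>The type \<open>'w\<close> may be infinite; only after the cut-off do the
    finitely many unit vectors \<open>e w\<close> with \<open>w\<close> in \<open>W\<close> span
    these functions.\<close>
  define Y where "Y u = (\<lambda>w. if w \<in> W then y u w else 0)" for u
  define e :: "'w \<Rightarrow> 'w \<Rightarrow> 'a" where "e w = (\<lambda>w'. if w' = w then 1 else 0)" for w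
  have pair: "(\<Sum>w\<in>W. x u w * Y v w) = (\<Sum>w\<in>W. x u w * y v w)" for u v
    by (simp add: Y_def)
  \<comment> \<open>If \<open>Y u = Y v\<close>, the pairing of \<open>x u\<close> with this
    function would be both nonzero and zero.\<close>
  have inj: "inj_on Y S"
  proof (rule inj_onI, rule ccontr)
    fix u v assume "u \<in> S" "v \<in> S" "Y u = Y v" "u \<noteq> v"
    then show False using diag[of u] off[of u v] pair[of u u] pair[of u v] by simp
  qed
  have "fs.independent (Y ` S)"
  proof (rule fs.independent_if_scalars_zero)
    fix f z assume f: "(\<Sum>z\<in>Y ` S. (\<lambda>w. f z * z w)) = 0" and "z \<in> Y ` S"
    then obtain u where u: "u \<in> S" "z = Y u" by blast
    have "(\<Sum>v\<in>S. f (Y v) * Y v w) = 0" for w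
    proof -
      have "(\<Sum>z\<in>Y ` S. f z * z w) = (\<Sum>z\<in>Y ` S. (\<lambda>w. f z * z w)) w"
        by (simp only: sum_fun_apply)
      then show ?thesis using f inj by (simp add: sum.reindex)
    qed
    \<comment> \<open>Pairing the vanishing combination with \<open>x u\<close> kills every term
      except \<open>v = u\<close>, leaving \<open>f (Y u)\<close> times a nonzero scalar.\<close>
    then have "0 = (\<Sum>w\<in>W. x u w * (\<Sum>v\<in>S. f (Y v) * Y v w))" by simp
    also have "\<dots> = (\<Sum>v\<in>S. f (Y v) * (\<Sum>w\<in>W. x u w * Y v w))"
      by (simp add: sum_distrib_left mult.left_commute) (rule sum.swap)
    also have "\<dots> = (\<Sum>v\<in>S. if v = u then f (Y u) * (\<Sum>w\<in>W. x u w * y u w) else 0)"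
      using off u(1) by (intro sum.cong) (auto simp: pair)
    also have "\<dots> = f (Y u) * (\<Sum>w\<in>W. x u w * y u w)"
      using assms(1) u(1) by simp
    finally show "f z = 0" using diag[OF u(1)] u(2) by simp
  qed (use assms(1) in simp)
  moreover have "Y ` S \<subseteq> fs.span (e ` W)"
  proof clarify
    fix u
    have "Y u = (\<Sum>w\<in>W. (\<lambda>w'. y u w * e w w'))"
      using assms(2) by (auto simp: Y_def e_def fun_eq_iff sum_fun_apply if_distrib cong: if_cong)
    then show "Y u \<in> fs.span (e ` W)"
      by (simp only:) (intro fs.span_sum fs.span_scale fs.span_base imageI)
  qed
  ultimately have "card (Y ` S) \<le> card (e ` W)"
    using fs.independent_span_bound assms(2) by blast
  then show ?thesis
    using card_image[OF inj] card_image_le[OF assms(2), of e] by simp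
qed

lemma independent_card_le_rank_power:
  fixes M :: "'a::field ^ 'v ^ 'v"
  assumes "independent_set (strong_power H t) S" "finite (pverts H)"
    and diag: "\<And>u. u \<in> pverts H \<Longrightarrow> M $ u $ u \<noteq> 0"
    and off: "\<And>u v. u \<in> pverts H \<Longrightarrow> v \<in> pverts H \<Longrightarrow> u \<noteq> v \<Longrightarrow> (u, v) \<notin> parcs H \<Longrightarrow> M $ u $ v = 0"
  shows "card S \<le> rank M ^ t"
proof -
  obtain B :: "('a ^ 'v) set" and c where B: "finite B" "card B = rank M"
    "\<And>u v. M $ u $ v = (\<Sum>b\<in>B. c b u * b $ v)"
    using rank_factorization by blast
  let ?W = "{bs. set bs \<subseteq> B \<and> length bs = t}"
  let ?V = "{us. set us \<subseteq> pverts H \<and> length us = t}"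
  have S: "S \<subseteq> ?V"
    using assms(1) by (auto simp: independent_set_def strong_power_def Let_def)
  \<comment> \<open>The right-hand side is the entry at \<open>us\<close>, \<open>vs\<close> of the
    Kronecker power of \<open>M\<close>; the left-hand side factors it through the
    \<open>card B ^ t\<close> words over \<open>B\<close>.\<close>
  have pairing: "(\<Sum>bs\<in>?W. (\<Prod>i<t. c (bs ! i) (us ! i)) * (\<Prod>i<t. bs ! i $ (vs ! i)))
      = (\<Prod>i<t. M $ (us ! i) $ (vs ! i))" for us vs
    by (simp add: B(3) prod_sum_lists[OF B(1)] prod.distrib)
  have "card S \<le> card ?W"
  proof (rule card_le_if_diagonal_pairing)
    show "finite S" using S finite_lists_length_eq[OF assms(2)] by (rule finite_subset)
    show "finite ?W" using B(1) by (rule finite_lists_length_eq)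
  next
    fix us assume "us \<in> S"
    then show "(\<Sum>bs\<in>?W. (\<Prod>i<t. c (bs ! i) (us ! i)) * (\<Prod>i<t. bs ! i $ (us ! i))) \<noteq> 0"
      unfolding pairing using S diag by (auto simp: subset_iff)
  next
    fix us vs assume *: "us \<in> S" "vs \<in> S" "us \<noteq> vs"
    then have "us \<in> ?V" "vs \<in> ?V" "(us, vs) \<notin> parcs (strong_power H t)"
      using assms(1) S by (auto simp only: independent_set_def)
    \<comment> \<open>Distinct non-adjacent words have a coordinate with distinct non-adjacent
      letters; \<open>M\<close> vanishes there, and this one factor makes the product zero.\<close>
    moreover from this \<open>us \<noteq> vs\<close> obtain i
      where "i < t" "us ! i \<noteq> vs ! i" "(us ! i, vs ! i) \<notin> parcs H"
      unfolding strong_power_def Let_def by auto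
    moreover from calculation have "us ! i \<in> pverts H" "vs ! i \<in> pverts H"
      by (auto simp: subset_iff)
    ultimately show "(\<Sum>bs\<in>?W. (\<Prod>i<t. c (bs ! i) (us ! i)) * (\<Prod>i<t. bs ! i $ (vs ! i))) = 0"
      unfolding pairing using off by (auto intro!: prod_zero)
  qed
  then show ?thesis by (simp add: card_lists_length_eq B)
qed

lemma finite_independent_sets: "finite (pverts H) \<Longrightarrow> finite {S. independent_set H S}"
  by (rule finite_subset[of _ "Pow (pverts H)"]) (auto simp: independent_set_def)

lemma independence_number_leI:
  assumes "finite (pverts H)" "\<And>S. independent_set H S \<Longrightarrow> card S \<le> n"
  shows "independence_number H \<le> n"
proof -
  \<comment> \<open>The empty set ensures that \<open>Max\<close> is taken over a nonempty
    family.\<close>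
  have "independent_set H {}" by (simp add: independent_set_def)
  then show ?thesis unfolding independence_number_def using assms finite_independent_sets
    by (subst Max_le_iff) auto
qed

lemma k_independence_number_leI:
  assumes "finite (pverts G)" "\<And>S. k_independent k G S \<Longrightarrow> card S \<le> n"
  shows "k_independence_number k G \<le> n"
proof -
  have "finite {S. k_independent k G S}"
    by (rule finite_subset[of _ "Pow (pverts G)"]) (auto simp: k_independent_def assms(1))
  moreover have "k_independent k G {}" by (simp add: k_independent_def)
  ultimately show ?thesis unfolding k_independence_number_def using assms
    by (subst Max_le_iff) auto
qed

lemma card_le_independence_number:
  assumes "finite (pverts H)" "independent_set H S"
  shows "card S \<le> independence_number H"
  unfolding independence_number_def using assms finite_independent_sets by (intro Max_ge) auto

lemma independent_set_power_graph:
  "k_independent k G S \<Longrightarrow> independent_set (power_graph G k) S"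
  by (force simp: k_independent_def independent_set_def power_graph_def)

text \<open>One-letter words carry independent sets into the term \<open>t = 1\<close> of the
  supremum, which gives the lower bound on the capacity.\<close>

lemma independent_set_strong_power_1:
  "independent_set H S \<Longrightarrow> independent_set (strong_power H 1) ((\<lambda>u. [u]) ` S)"
  by (auto simp: independent_set_def strong_power_def Let_def)

theorem theorem16:
  fixes k :: nat
    and G :: "'v::finite pair_pre_digraph"
    and A :: "'a::field ^ 'v ^ 'v"
    and p :: "'a poly"
  assumes "k \<ge> 1"
    and "pair_graph G"
    and "pverts G = UNIV"
    and "A \<in> graph_matrices G"
    and "degree p \<le> k"
    and "\<And>u. u \<in> pverts G \<Longrightarrow> matrix_poly p A $ u $ u \<noteq> 0"
  shows "real (k_independence_number k G) \<le> shannon_capacity (power_graph G k) \<and>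
         shannon_capacity (power_graph G k) \<le> real (rank (matrix_poly p A))"
proof
  let ?H = "power_graph G k" and ?M = "matrix_poly p A"
  have fin: "finite (pverts (strong_power ?H t))" for t
  proof -
    interpret pair_graph "strong_power ?H t"
      by (intro pair_graph_strong_power pair_graph_power_graph assms(2))
    show ?thesis by (rule pair_finite_verts)
  qed
  have "card S \<le> independence_number (strong_power ?H 1)" if "k_independent k G S" for S
    using card_le_independence_number[OF fin independent_set_strong_power_1
        [OF independent_set_power_graph[OF that]]]
    by (simp add: card_image inj_on_def)
  then have "k_independence_number k G \<le> independence_number (strong_power ?H 1)"
    by (intro k_independence_number_leI) auto
  then have "real (k_independence_number k G)
      \<le> root 1 (real (independence_number (strong_power ?H 1)))" by simp
  also have "\<dots> \<le> shannon_capacity ?H"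
    unfolding shannon_capacity_def
    \<comment> \<open>In the reals, a term lies below the supremum only once the family is known to
      be bounded above.\<close>
    by (rule cSUP_upper[OF _ bdd_above_shannon]) (simp_all add: power_graph_def)
  finally show "real (k_independence_number k G) \<le> shannon_capacity ?H" .
  have "root t (real (independence_number (strong_power ?H t))) \<le> real (rank ?M)"
    if "t \<ge> 1" for t
  proof -
    have "independence_number (strong_power ?H t) \<le> rank ?M ^ t"
    proof (rule independence_number_leI[OF fin], rule independent_card_le_rank_power)
      \<comment> \<open>Non-adjacency of distinct vertices in the power graph means distance greater
        than \<open>k\<close> in \<open>G\<close>.\<close>
      fix u v assume "u \<in> pverts ?H" "v \<in> pverts ?H" "u \<noteq> v" "(u, v) \<notin> parcs ?H"
      then show "?M $ u $ v = 0"
        by (intro matrix_poly_eq_0_if_distant[OF assms(2-5)]) (auto simp: power_graph_def)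
    qed (use assms(3,6) in \<open>auto simp: power_graph_def\<close>)
    then have "root t (real (independence_number (strong_power ?H t))) \<le> root t (real (rank ?M) ^ t)"
      using that by (intro real_root_le_mono) (auto simp flip: of_nat_power)
    then show ?thesis using that by (simp add: real_root_power_cancel)
  qed
  then show "shannon_capacity ?H \<le> real (rank ?M)"
    unfolding shannon_capacity_def by (intro cSUP_least) auto
qed

end
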